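(* Let $G=(V,E)$ be a graph and let $v_1,v_2,\dots$ be a permutation (enumeration) of the vertices such that for all $N\in\mathbb{N}$ both $$\partial_V(N)=\#\,\partial_E(\{v_1,\dots,v_N\})$$ and every endpoint of every edge in $\partial_E(\{v_1,\dots,v_N\})$ lies in $\{v_1,\dots,v_{N+\partial_V(N)}\}$. Then for every $f:V\to\mathbb{R}_{\ge 0}$ the associated rearrangement $f^*$ satisfies, for all $1\le p\le\infty$, $$\|\nabla f^*\|_{L^p}\le\|\nabla f\|_{L^p}.$$
   Context: For $A\subseteq V$, the edge boundary is $\partial_E(A)=\{e\in E: e \text{ joins a vertex of } A \text{ to a vertex of } V\setminus A\}$. The vertex-isoperimetric profile $\partial_V(k)$, for $k\in\mathbb{N}$, is the largest integer such that every set $A\subseteq V$ with $\#A=k$ is adjacent to at least $\partial_V(k)$ vertices of $V\setminus A$. For $g:V\to\mathbb{R}$: $\|\nabla g\|_{L^p}^p=\sum_{(v,w)\in E}|g(v)-g(w)|^p$ for $1\le p<\infty$ (each edge counted once), and $\|\nabla g\|_{L^\infty}=\sup_{(v,w)\in E}|g(v)-g(w)|$. Given the enumeration $v_1,v_2,\dots$ of $V$, the associated rearrangement of a nonnegative function $f$ is $f^*$ defined by $f^*(v_k)=$ the $k$-th largest value assumed by $f$ (values counted with multiplicity). *)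

theory Defs
  imports "HOL-Analysis.Analysis"
begin

definition simple_graph :: "'a set \<Rightarrow> 'a set set \<Rightarrow> bool" where
  "simple_graph V E \<longleftrightarrow> (\<forall>e\<in>E. \<exists>x\<in>V. \<exists>y\<in>V. x \<noteq> y \<and> e = {x, y})"

text \<open>Infinite sets count as having at least \<open>k\<close> elements for every \<open>k\<close>.\<close>

definition at_least :: "nat \<Rightarrow> 'a set \<Rightarrow> bool" where
  "at_least k S \<longleftrightarrow> (\<exists>T\<subseteq>S. finite T \<and> card T = k)"

lemma at_least_iff: "at_least k S \<longleftrightarrow> infinite S \<or> k \<le> card S"
  unfolding at_least_def
  by (metis card_mono infinite_arbitrarily_large obtain_subset_with_card_n)

definition edge_boundary :: "'a set \<Rightarrow> 'a set set \<Rightarrow> 'a set \<Rightarrow> 'a set set" where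
  "edge_boundary V E A = {e \<in> E. \<exists>x\<in>A. \<exists>y\<in>V - A. e = {x, y}}"

definition vertex_boundary :: "'a set \<Rightarrow> 'a set set \<Rightarrow> 'a set \<Rightarrow> 'a set" where
  "vertex_boundary V E A = {y \<in> V - A. \<exists>x\<in>A. {x, y} \<in> E}"

text \<open>The greatest integer below exists whenever some \<open>k\<close>-element set has a finite vertex
  boundary, see \<open>vertex_profile_greatest\<close>; otherwise the value is unspecified.\<close>

definition vertex_profile :: "'a set \<Rightarrow> 'a set set \<Rightarrow> nat \<Rightarrow> nat" where
  "vertex_profile V E k =
     (GREATEST m. \<forall>A\<subseteq>V. finite A \<and> card A = k \<longrightarrow> at_least m (vertex_boundary V E A))"

lemma vertex_profile_greatest:
  assumes "A\<^sub>0 \<subseteq> V" "finite A\<^sub>0" "card A\<^sub>0 = k" "finite (vertex_boundary V E A\<^sub>0)"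
  shows "\<forall>A\<subseteq>V. finite A \<and> card A = k \<longrightarrow> at_least (vertex_profile V E k) (vertex_boundary V E A)"
    and "(\<forall>A\<subseteq>V. finite A \<and> card A = k \<longrightarrow> at_least m (vertex_boundary V E A)) \<Longrightarrow>
           m \<le> vertex_profile V E k"
proof -
  let ?P = "\<lambda>m. \<forall>A\<subseteq>V. finite A \<and> card A = k \<longrightarrow> at_least m (vertex_boundary V E A)"
  have bound: "m \<le> card (vertex_boundary V E A\<^sub>0)" if "?P m" for m
    using that assms by (auto simp: at_least_iff)
  have "?P 0" by (simp add: at_least_iff)
  then show "?P (vertex_profile V E k)"
    unfolding vertex_profile_def by (rule GreatestI_nat) (rule bound)
  show "m \<le> vertex_profile V E k" if "?P m"
    unfolding vertex_profile_def using that by (rule Greatest_le_nat) (rule bound)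
qed

text \<open>Positions \<open>1, 2, \<dots>\<close> of an enumeration of \<open>V\<close>; they stop at \<open>card V\<close> if \<open>V\<close> is finite.\<close>

definition positions :: "'a set \<Rightarrow> nat set" where
  "positions V = {k. 1 \<le> k \<and> (finite V \<longrightarrow> k \<le> card V)}"

definition enumeration :: "(nat \<Rightarrow> 'a) \<Rightarrow> 'a set \<Rightarrow> bool" where
  "enumeration v V \<longleftrightarrow> bij_betw v (positions V) V"

text \<open>The \<open>k\<close>-th largest value with multiplicity is the largest \<open>c\<close> such that \<open>f \<ge> c\<close> on at least
  \<open>k\<close> vertices.  The supremum is that maximum whenever a \<open>k\<close>-th largest value is assumed, see
  \<open>kth_largest_eq\<close>.  It also gives the usual value for bounded functions for which it is not
  assumed.  If \<open>f\<close> is unbounded above, the set is all of \<open>\<real>\<close> for every \<open>k\<close>, and the value is an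
  unspecified real independent of \<open>k\<close>.\<close>

definition kth_largest :: "'a set \<Rightarrow> ('a \<Rightarrow> real) \<Rightarrow> nat \<Rightarrow> real" where
  "kth_largest V f k = Sup {c. at_least k {x \<in> V. c \<le> f x}}"

lemma kth_largest_eq:
  assumes "at_least k {x \<in> V. c \<le> f x}" "\<not> at_least k {x \<in> V. c < f x}"
  shows "kth_largest V f k = c"
  unfolding kth_largest_def
proof (rule cSup_eq_maximum)
  show "c \<in> {c. at_least k {x \<in> V. c \<le> f x}}" using assms by simp
  fix d assume "d \<in> {c. at_least k {x \<in> V. c \<le> f x}}"
  then obtain T where T: "T \<subseteq> {x \<in> V. d \<le> f x}" "finite T" "card T = k"
    by (auto simp: at_least_def)
  show "d \<le> c"
  proof (rule ccontr)
    assume "\<not> d \<le> c"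
    then have "T \<subseteq> {x \<in> V. c < f x}" using T(1) by auto
    then show False using T(2,3) assms(2) unfolding at_least_def by blast
  qed
qed

definition rearrangement :: "'a set \<Rightarrow> (nat \<Rightarrow> 'a) \<Rightarrow> ('a \<Rightarrow> real) \<Rightarrow> 'a \<Rightarrow> real" where
  "rearrangement V v f x = kth_largest V f (the_inv_into (positions V) v x)"

lemma rearrangement_enumeration:
  assumes "enumeration v V" "k \<in> positions V"
  shows "rearrangement V v f (v k) = kth_largest V f k"
  using assms
  by (simp add: rearrangement_def enumeration_def bij_betw_def the_inv_into_f_f)

definition edge_diff :: "('a \<Rightarrow> real) \<Rightarrow> 'a set \<Rightarrow> real" where
  "edge_diff g e = (THE d. \<exists>x y. e = {x, y} \<and> d = \<bar>g x - g y\<bar>)"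

lemma edge_diff_pair [simp]: "edge_diff g {x, y} = \<bar>g x - g y\<bar>"
  unfolding edge_diff_def by (rule the_equality) (auto simp: doubleton_eq_iff)

definition ennreal_root :: "real \<Rightarrow> ennreal \<Rightarrow> ennreal" where
  "ennreal_root p s = (if s = \<infinity> then \<infinity> else ennreal (enn2real s powr (1 / p)))"

text \<open>Integration against the counting measure on \<open>E\<close> is the sum over all edges, each once.\<close>

definition grad_norm :: "'a set set \<Rightarrow> ennreal \<Rightarrow> ('a \<Rightarrow> real) \<Rightarrow> ennreal" where
  "grad_norm E p g =
     (if p = \<infinity> then (SUP e\<in>E. ennreal (edge_diff g e))
      else ennreal_root (enn2real p)
             (\<integral>\<^sup>+ e. ennreal (edge_diff g e powr enn2real p) \<partial>count_space E))"

end

theory Submission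
  imports Defs
begin

text \<open>Compare two levels \<open>s \<le> t\<close>: let \<open>A = {f > t}\<close> and \<open>B = {f > s}\<close> have \<open>N\<close> and \<open>M\<close> elements.  At least
  \<open>\<partial>\<^sub>V(N) - (M - N)\<close> vertices outside \<open>B\<close> are adjacent to \<open>A\<close>, hence at least so many edges join
  \<open>{f > t}\<close> to \<open>{f \<le> s}\<close>.  For the rearrangement these two sets are the initial segment
  \<open>v\<^sub>1, \<dots>, v\<^sub>N\<close> and the complement of \<open>v\<^sub>1, \<dots>, v\<^sub>M\<close>; the hypotheses force the boundary edges of the
  former to have the distinct outer ends \<open>v\<^sub>N\<^sub>+\<^sub>1, v\<^sub>N\<^sub>+\<^sub>2, \<dots>\<close>, \<open>\<partial>\<^sub>V(N)\<close> in number, so the bound is attained.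
  Integrating over \<open>s\<close> with \<open>t = s + h\<close> shows that \<open>\<Sum>\<^sub>e (|\<nabla>f(e)| - h)\<^sub>+\<close> does not increase, for each
  \<open>h \<ge> 0\<close>, and all the \<open>L\<^sup>p\<close> norms are monotone in these quantities.\<close>

text \<open>The inequality is weak at \<open>s\<close> and strict at \<open>t\<close>, so that the
  two ends lie in the complement of \<open>{g > s}\<close> and in \<open>{g > t}\<close>: only
  strict superlevel sets occur, and for the rearrangement these are initial segments.\<close>

definition level_edges :: "'a set set \<Rightarrow> ('a \<Rightarrow> real) \<Rightarrow> real \<Rightarrow> real \<Rightarrow> 'a set set" where
  "level_edges E g s t = {e \<in> E. \<exists>x y. e = {x, y} \<and> g x \<le> s \<and> t < g y}"

text \<open>Since \<open>ennreal\<close> sends negative reals to 0, each edge contributes the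
  positive part of its difference minus \<open>h\<close>.\<close>

definition excess :: "'a set set \<Rightarrow> ('a \<Rightarrow> real) \<Rightarrow> real \<Rightarrow> ennreal" where
  "excess E g h = (\<integral>\<^sup>+ e. ennreal (edge_diff g e - h) \<partial>count_space E)"

section \<open>Edges of a simple graph\<close>

lemma simple_graph_edgeE:
  assumes "simple_graph V E" "e \<in> E"
  obtains x y where "x \<in> V" "y \<in> V" "x \<noteq> y" "e = {x, y}"
  using assms unfolding simple_graph_def by blast

lemma simple_graph_ends:
  assumes "simple_graph V E" "{x, y} \<in> E"
  shows "x \<in> V" "y \<in> V"
  using assms by (metis simple_graph_edgeE doubleton_eq_iff)+

lemma edge_diff_nonneg:
  assumes "simple_graph V E" "e \<in> E"
  shows "0 \<le> edge_diff g e"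
  using assms by (metis simple_graph_edgeE edge_diff_pair abs_ge_zero)

lemma simple_graph_countable:
  assumes "simple_graph V E" "countable V"
  shows "countable E"
proof -
  have "E \<subseteq> (\<lambda>(x, y). {x, y}) ` (V \<times> V)"
    using assms(1) by (force elim: simple_graph_edgeE)
  then show ?thesis
    using assms(2) by (meson countable_SIGMA countable_image countable_subset)
qed

subsection \<open>Distribution of the rearrangement\<close>

lemma at_least_subset: "at_least k S \<Longrightarrow> S \<subseteq> T \<Longrightarrow> at_least k T"
  unfolding at_least_def by blast

lemma at_least_positions:
  assumes "k \<in> positions V"
  shows "at_least k V"
  using assms by (auto simp: positions_def at_least_iff)

text \<open>Every superlevel set is infinite, so the value is unspecified but the same for all
  \<open>k\<close>; the rearrangement is then constant and has no edges between levels.\<close>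

lemma kth_largest_unbounded:
  assumes "\<not> bdd_above (f ` V)"
  shows "kth_largest V f k = Sup UNIV"
proof -
  have "infinite {x \<in> V. c \<le> f x}" for c
  proof
    assume fin: "finite {x \<in> V. c \<le> f x}"
    have "f ` V \<subseteq> f ` {x \<in> V. c \<le> f x} \<union> {..c}" by force
    moreover have "bdd_above (f ` {x \<in> V. c \<le> f x} \<union> {..c})"
      using fin by simp
    ultimately show False using assms by (metis bdd_above_mono)
  qed
  then show ?thesis by (simp add: kth_largest_def at_least_iff)
qed

text \<open>A supremum exceeds \<open>t\<close> iff some admissible \<open>c\<close> does.
  Conversely, \<open>k\<close> vertices with values above \<open>t\<close> have a least value, which
  is such a \<open>c\<close>. Nonnegativity makes 0 admissible, so the supremum is over a nonempty
  set.\<close>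

lemma less_kth_largest_iff:
  assumes k: "k \<in> positions V" and bdd: "bdd_above (f ` V)" and nonneg: "\<And>x. x \<in> V \<Longrightarrow> 0 \<le> f x"
  shows "t < kth_largest V f k \<longleftrightarrow> at_least k {x \<in> V. t < f x}"
proof -
  let ?C = "{c. at_least k {x \<in> V. c \<le> f x}}"
  have k1: "1 \<le> k" using k by (simp add: positions_def)
  have "{x \<in> V. 0 \<le> f x} = V" using nonneg by auto
  then have "0 \<in> ?C" using at_least_positions[OF k] by simp
  then have ne: "?C \<noteq> {}" by blast
  obtain b where b: "\<And>x. x \<in> V \<Longrightarrow> f x \<le> b" using bdd by (auto simp: bdd_above_def)
  have "bdd_above ?C"
  proof (rule bdd_aboveI)
    fix c assume "c \<in> ?C"
    then obtain T where T: "T \<subseteq> {x \<in> V. c \<le> f x}" "finite T" "card T = k"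
      by (auto simp: at_least_def)
    then have "T \<noteq> {}" using k1 by auto
    then show "c \<le> b" using T(1) b by force
  qed
  then have "t < kth_largest V f k \<longleftrightarrow> (\<exists>c\<in>?C. t < c)"
    unfolding kth_largest_def using ne by (simp add: less_cSup_iff)
  also have "\<dots> \<longleftrightarrow> at_least k {x \<in> V. t < f x}"
  proof
    assume "\<exists>c\<in>?C. t < c"
    then show "at_least k {x \<in> V. t < f x}" by (auto elim: at_least_subset)
  next
    assume "at_least k {x \<in> V. t < f x}"
    then obtain T where T: "T \<subseteq> {x \<in> V. t < f x}" "finite T" "card T = k"
      by (auto simp: at_least_def)
    then have ne: "T \<noteq> {}" using k1 by auto
    have "t < Min (f ` T)" using T ne by auto
    moreover have "at_least k {x \<in> V. Min (f ` T) \<le> f x}"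
      unfolding at_least_def using T by (intro exI[of _ T]) auto
    ultimately show "\<exists>c\<in>?C. t < c" by blast
  qed
  finally show ?thesis .
qed

subsection \<open>Edges between two level sets\<close>

text \<open>Each boundary vertex of \<open>?A\<close> outside \<open>?B\<close> selects an edge to
  \<open>?A\<close>. That vertex is the only end of the edge with value at most \<open>s\<close>, so
  distinct vertices select distinct edges; the other boundary vertices lie in
  \<open>?B - ?A\<close>.\<close>

lemma card_level_edges_ge:
  fixes f :: "'a \<Rightarrow> real"
  assumes "s \<le> t"
    and finB: "finite {x \<in> V. s < f x}"
    and finL: "finite (level_edges E f s t)"
    and m: "at_least m (vertex_boundary V E {x \<in> V. t < f x})"
  shows "m \<le> card (level_edges E f s t) + (card {x \<in> V. s < f x} - card {x \<in> V. t < f x})"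
proof -
  let ?A = "{x \<in> V. t < f x}" and ?B = "{x \<in> V. s < f x}" and ?L = "level_edges E f s t"
  let ?bd = "vertex_boundary V E ?A"
  have AB: "?A \<subseteq> ?B" using \<open>s \<le> t\<close> by auto
  then have finA: "finite ?A" using finB finite_subset by blast
  have "\<exists>e. e \<in> ?L \<and> y \<in> e \<and> (\<forall>z\<in>e. f z \<le> s \<longrightarrow> z = y)" if y: "y \<in> ?bd - ?B" for y
  proof -
    obtain x where x: "x \<in> ?A" "{x, y} \<in> E" using y by (auto simp: vertex_boundary_def)
    have "f y \<le> s" using y by (auto simp: vertex_boundary_def)
    then have "{x, y} \<in> ?L" using x unfolding level_edges_def by (auto simp: insert_commute)
    then show ?thesis using x \<open>s \<le> t\<close> by (intro exI[of _ "{x, y}"]) auto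
  qed
  then obtain \<phi> where \<phi>: "\<And>y. y \<in> ?bd - ?B \<Longrightarrow> \<phi> y \<in> ?L \<and> y \<in> \<phi> y \<and> (\<forall>z\<in>\<phi> y. f z \<le> s \<longrightarrow> z = y)"
    by metis
  have "inj_on \<phi> (?bd - ?B)"
  proof (rule inj_onI)
    fix y z assume yz: "y \<in> ?bd - ?B" "z \<in> ?bd - ?B" "\<phi> y = \<phi> z"
    have "f y \<le> s" using yz(1) by (auto simp: vertex_boundary_def)
    then show "y = z" using \<phi>[OF yz(1)] \<phi>[OF yz(2)] yz(3) by simp
  qed
  moreover have "\<phi> ` (?bd - ?B) \<subseteq> ?L" using \<phi> by blast
  ultimately have fin: "finite (?bd - ?B)" and le: "card (?bd - ?B) \<le> card ?L"
    using finL by (simp_all add: inj_on_finite card_inj_on_le)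
  have sub: "?bd \<subseteq> (?bd - ?B) \<union> (?B - ?A)" by (auto simp: vertex_boundary_def)
  then have "finite ?bd" using fin finB by (meson finite_Diff finite_UnI finite_subset)
  then have "m \<le> card ?bd" using m by (simp add: at_least_iff)
  also have "\<dots> \<le> card ((?bd - ?B) \<union> (?B - ?A))" using sub fin finB by (intro card_mono) auto
  also have "\<dots> \<le> card (?bd - ?B) + card (?B - ?A)" by (rule card_Un_le)
  also have "card (?B - ?A) = card ?B - card ?A" using finA AB by (rule card_Diff_subset)
  finally show ?thesis using le by simp
qed

text \<open>As many boundary edges as outer boundary vertices: no two of these edges share their outer end.\<close>

lemma outer_end_boundary_edges:
  assumes fin: "finite (edge_boundary V E A)"
    and le: "card (edge_boundary V E A) \<le> card (vertex_boundary V E A)"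
  obtains out where "inj_on out (edge_boundary V E A)"
    and "out ` edge_boundary V E A = vertex_boundary V E A"
    and "\<And>x y. x \<in> A \<Longrightarrow> y \<in> V - A \<Longrightarrow> {x, y} \<in> E \<Longrightarrow> out {x, y} = y"
proof -
  define out where "out e = (THE y. y \<in> e \<and> y \<notin> A)" for e
  have out: "out {x, y} = y" if "x \<in> A" "y \<in> V - A" for x y
    unfolding out_def using that by (intro the_equality) auto
  have im: "out ` edge_boundary V E A = vertex_boundary V E A"
  proof
    show "out ` edge_boundary V E A \<subseteq> vertex_boundary V E A"
      using out by (auto simp: edge_boundary_def vertex_boundary_def)
    show "vertex_boundary V E A \<subseteq> out ` edge_boundary V E A"
    proof
      fix y assume "y \<in> vertex_boundary V E A"
      then obtain x where x: "x \<in> A" "{x, y} \<in> E" "y \<in> V - A" by (auto simp: vertex_boundary_def)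
      then have "{x, y} \<in> edge_boundary V E A" by (auto simp: edge_boundary_def)
      then show "y \<in> out ` edge_boundary V E A" using out[OF x(1,3)] by (metis image_eqI)
    qed
  qed
  \<comment> \<open>A map from a finite set onto one with at least as many elements is
    injective.\<close>
  have "inj_on out (edge_boundary V E A)"
    using fin le card_image_le[OF fin, of out] by (simp add: im eq_card_imp_inj_on)
  then show ?thesis using that im out by blast
qed

lemma emeasure_level_edges_rearrangement:
  fixes V :: "'a set" and E :: "'a set set" and v :: "nat \<Rightarrow> 'a" and f :: "'a \<Rightarrow> real"
  assumes graph: "simple_graph V E" and enum: "enumeration v V"
    and boundary: "\<And>N. N \<in> positions V \<Longrightarrow>
           finite (edge_boundary V E (v ` {1..N})) \<and>
           vertex_profile V E N = card (edge_boundary V E (v ` {1..N}))"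
    and ends: "\<And>N e x. N \<in> positions V \<Longrightarrow> e \<in> edge_boundary V E (v ` {1..N}) \<Longrightarrow> x \<in> e \<Longrightarrow>
           x \<in> v ` {1..N + vertex_profile V E N}"
    and nonneg: "\<And>x. x \<in> V \<Longrightarrow> 0 \<le> f x"
    and "s \<le> t"
  shows "emeasure (count_space E) (level_edges E (rearrangement V v f) s t) \<le>
    emeasure (count_space E) (level_edges E f s t)"
proof -
  let ?g = "rearrangement V v f"
  let ?Lg = "level_edges E ?g s t" and ?L = "level_edges E f s t"
  let ?A = "{x \<in> V. t < f x}" and ?B = "{x \<in> V. s < f x}"
  let ?N = "card ?A" and ?M = "card ?B"
  have inj: "inj_on v (positions V)" and img: "v ` positions V = V"
    using enum by (auto simp: enumeration_def bij_betw_def)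
  have Lg: "\<exists>i\<in>positions V. \<exists>j\<in>positions V. e = {v i, v j} \<and> ?g (v i) \<le> s \<and> t < ?g (v j)"
    if e: "e \<in> ?Lg" for e
  proof -
    obtain x y where xy: "e \<in> E" "e = {x, y}" "?g x \<le> s" "t < ?g y"
      using e unfolding level_edges_def by blast
    then have "x \<in> v ` positions V" "y \<in> v ` positions V"
      using simple_graph_ends[OF graph] img by auto
    then show ?thesis using xy by blast
  qed
  have measurable: "?Lg \<subseteq> E" "?L \<subseteq> E" by (auto simp: level_edges_def)
  \<comment> \<open>Only the third case has content: an edge in \<open>?Lg\<close> provides
    positions \<open>i\<close> and \<open>j\<close> on both sides of the gap, which make
    \<open>f\<close> bounded and the superlevel sets finite and nonempty.\<close>
  consider "?Lg = {}" | "infinite ?L" | "finite ?L" "?Lg \<noteq> {}" by blast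
  then show ?thesis
  proof cases
    case 3
    then obtain i j where ij: "i \<in> positions V" "j \<in> positions V" "?g (v i) \<le> s" "t < ?g (v j)"
      using Lg by blast
    have bdd: "bdd_above (f ` V)"
    proof (rule ccontr)
      assume "\<not> bdd_above (f ` V)"
      then have "?g (v i) = ?g (v j)"
        using ij(1,2) by (simp add: rearrangement_enumeration[OF enum] kth_largest_unbounded)
      then show False using ij(3,4) \<open>s \<le> t\<close> by linarith
    qed
    have g_less: "u < ?g (v k) \<longleftrightarrow> at_least k {x \<in> V. u < f x}" if "k \<in> positions V" for u k
      using less_kth_largest_iff[OF that bdd nonneg] rearrangement_enumeration[OF enum that] by simp
    \<comment> \<open>The rearrangement is at most \<open>s\<close> at position \<open>i\<close>, so
      fewer than \<open>i\<close> vertices have \<open>f > s\<close>.\<close>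
    have finB: "finite ?B" using ij(3) g_less[OF ij(1), of s] by (auto simp: at_least_iff)
    have AB: "?A \<subseteq> ?B" using \<open>s \<le> t\<close> by auto
    then have finA: "finite ?A" using finB finite_subset by blast
    \<comment> \<open>As \<open>j\<close> is at least 1, so is \<open>?N\<close>; the hypotheses
      speak only of positive positions.\<close>
    have "j \<le> ?N" using ij(4) g_less[OF ij(2), of t] finA by (auto simp: at_least_iff)
    moreover have "?N \<le> card V" if "finite V" using that by (intro card_mono) auto
    ultimately have N: "?N \<in> positions V" using ij(2) by (auto simp: positions_def)
    have NM: "?N \<le> ?M" using AB finB by (rule card_mono[rotated])
    define I where "I = v ` {1..?N}"
    have seg: "{1..?N} \<subseteq> positions V" using N by (auto simp: positions_def)
    then have I: "I \<subseteq> V" "finite I" "card I = ?N"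
      using img inj_on_subset[OF inj seg] by (auto simp: I_def card_image)
    define b where "b = card (edge_boundary V E I)"
    have finE: "finite (edge_boundary V E I)" and b: "vertex_profile V E ?N = b"
      using boundary[OF N] by (auto simp: I_def b_def)
    \<comment> \<open>A finite vertex boundary is needed for the greatest integer defining the
      profile to exist.\<close>
    have "vertex_boundary V E I \<subseteq> \<Union> (edge_boundary V E I)"
      by (auto simp: vertex_boundary_def edge_boundary_def)
    moreover have "finite (\<Union> (edge_boundary V E I))"
      using finE by (auto simp: edge_boundary_def)
    ultimately have finV: "finite (vertex_boundary V E I)" by (rule finite_subset)
    note profile = vertex_profile_greatest(1)[OF I finV, unfolded b]
    \<comment> \<open>Testing the profile on \<open>I\<close> itself gives at least as many outer
      boundary vertices as boundary edges.\<close>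
    have "b \<le> card (vertex_boundary V E I)" using profile I finV by (auto simp: at_least_iff)
    then obtain out where out: "inj_on out (edge_boundary V E I)"
      "out ` edge_boundary V E I = vertex_boundary V E I"
      "\<And>x y. x \<in> I \<Longrightarrow> y \<in> V - I \<Longrightarrow> {x, y} \<in> E \<Longrightarrow> out {x, y} = y"
      using outer_end_boundary_edges[OF finE] unfolding b_def by metis
    \<comment> \<open>\<open>I\<close> and its \<open>b\<close> outer boundary vertices are disjoint
      in \<open>V\<close>, so the positions up to \<open>?N + b\<close> exist even for finite
      \<open>V\<close>, and \<open>v\<close> is injective on them.\<close>
    have Nb: "k \<in> positions V" if "k \<in> {1..?N + b}" for k
    proof -
      have b_eq: "b = card (vertex_boundary V E I)" using out(1,2) b_def card_image by metis
      have "?N + b \<le> card V" if "finite V"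
      proof -
        have "I \<inter> vertex_boundary V E I = {}" by (auto simp: vertex_boundary_def)
        then have "?N + b = card (I \<union> vertex_boundary V E I)"
          using I finV b_eq by (simp add: card_Un_disjoint)
        also have "\<dots> \<le> card V"
          using that I by (intro card_mono) (auto simp: vertex_boundary_def)
        finally show ?thesis .
      qed
      then show ?thesis using that by (auto simp: positions_def)
    qed
    \<comment> \<open>The inner end has position at most \<open>?N\<close> and the outer end one
      beyond \<open>?M\<close>; the hypothesis on endpoints bounds the latter by
      \<open>?N + b\<close>.\<close>
    have Lg_out: "e \<in> edge_boundary V E I \<and> out e \<in> v ` {?M<..?N + b}" if e: "e \<in> ?Lg" for e
    proof -
      obtain i j where ij: "i \<in> positions V" "j \<in> positions V" "e = {v i, v j}"
        "?g (v i) \<le> s" "t < ?g (v j)" using Lg[OF e] by blast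
      have "e \<in> E" using e by (simp add: level_edges_def)
      have i: "?M < i" using ij(4) g_less[OF ij(1), of s] finB by (auto simp: at_least_iff)
      have j: "j \<le> ?N" using ij(5) g_less[OF ij(2), of t] finA by (auto simp: at_least_iff)
      have jI: "v j \<in> I" using j ij(2) by (auto simp: I_def positions_def)
      have "v i \<notin> I"
      proof
        assume "v i \<in> I"
        then obtain k where "k \<in> {1..?N}" "v i = v k" by (auto simp: I_def)
        then have "i = k" using inj_onD[OF inj, of i k] ij(1) seg by blast
        then show False using i NM \<open>k \<in> {1..?N}\<close> by simp
      qed
      then have iI: "v i \<in> V - I" using img ij(1) by blast
      have bd: "e \<in> edge_boundary V E I"
        using \<open>e \<in> E\<close> iI jI ij(3) unfolding edge_boundary_def by blast
      have oe: "out e = v i"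
        using out(3)[OF jI iI] \<open>e \<in> E\<close> ij(3) by (simp add: insert_commute)
      have "v i \<in> v ` {1..?N + b}" using ends[OF N, of e "v i"] bd ij(3) b by (simp add: I_def)
      then obtain k where k: "k \<in> {1..?N + b}" "v i = v k" by blast
      then have "i = k" using inj_onD[OF inj, of i k] ij(1) Nb by blast
      then show ?thesis using bd oe i k by auto
    qed
    then have sub: "?Lg \<subseteq> edge_boundary V E I" and im: "out ` ?Lg \<subseteq> v ` {?M<..?N + b}" by blast+
    have finLg: "finite ?Lg" using sub finE finite_subset by blast
    have "card ?Lg = card (out ` ?Lg)" using inj_on_subset[OF out(1) sub] by (simp add: card_image)
    also have "\<dots> \<le> card (v ` {?M<..?N + b})" using im by (intro card_mono) auto
    also have "\<dots> \<le> card {?M<..?N + b}" by (rule card_image_le) simp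
    finally have upper: "card ?Lg \<le> ?N + b - ?M" by simp
    have "b \<le> card ?L + (?M - ?N)"
      using profile finA by (intro card_level_edges_ge[OF \<open>s \<le> t\<close> finB 3(1)]) auto
    then have "card ?Lg \<le> card ?L" using upper NM by linarith
    then show ?thesis
      using 3(1) finLg measurable by (simp add: emeasure_count_space_finite)
  qed (use measurable in \<open>auto simp: emeasure_count_space_infinite\<close>)
qed

subsection \<open>From level sets to norms\<close>

text \<open>Layer cake: an edge with end values a \<le> b is counted exactly for \<open>s\<close> in
  [a, b - h), an interval of length b - a - h or empty. Sum and integral are exchanged by
  Tonelli.\<close>

lemma excess_eq_integral_level_edges:
  assumes graph: "simple_graph V E" and "countable E" and "0 \<le> h"
  shows "excess E g h = (\<integral>\<^sup>+ s. emeasure (count_space E) (level_edges E g s (s + h)) \<partial>lborel)"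
proof -
  have edge: "(\<lambda>s. indicator (level_edges E g s (s + h)) e :: ennreal) \<in> borel_measurable borel \<and>
     (\<integral>\<^sup>+ s. indicator (level_edges E g s (s + h)) e \<partial>lborel) = ennreal (edge_diff g e - h)"
    if e: "e \<in> E" for e
  proof -
    obtain x y where xy: "e = {x, y}" using graph e by (elim simple_graph_edgeE)
    \<comment> \<open>As \<open>h\<close> is nonnegative, an edge can be counted only in the
      direction from its smaller to its larger value.\<close>
    have eq: "indicator (level_edges E g s (s + h)) e =
        (indicator {min (g x) (g y)..<max (g x) (g y) - h} s :: ennreal)" for s
    proof -
      have "(\<exists>a b. {x, y} = {a, b} \<and> g a \<le> s \<and> s + h < g b) \<longleftrightarrow>
          g x \<le> s \<and> s + h < g y \<or> g y \<le> s \<and> s + h < g x"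
        by (metis doubleton_eq_iff)
      then show ?thesis
        using e \<open>0 \<le> h\<close> by (auto simp: level_edges_def indicator_def xy min_def max_def)
    qed
    have "emeasure lborel {min (g x) (g y)..<max (g x) (g y) - h} = ennreal (edge_diff g e - h)"
    proof (cases "min (g x) (g y) \<le> max (g x) (g y) - h")
      case True
      then show ?thesis by (simp add: xy abs_real_def min_def max_def algebra_simps)
    next
      case False
      then show ?thesis by (simp add: xy abs_real_def min_def max_def ennreal_neg split: if_splits)
    qed
    then show ?thesis by (simp add: eq)
  qed
  have "excess E g h =
      (\<integral>\<^sup>+ e. (\<integral>\<^sup>+ s. indicator (level_edges E g s (s + h)) e \<partial>lborel) \<partial>count_space E)"
    unfolding excess_def by (intro nn_integral_cong) (simp add: edge)
  also have "\<dots> = (\<integral>\<^sup>+ s. (\<integral>\<^sup>+ e. indicator (level_edges E g s (s + h)) e \<partial>count_space E) \<partial>lborel)"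
    using \<open>countable E\<close> edge by (intro nn_integral_count_space_nn_integral[symmetric]) auto
  also have "\<dots> = (\<integral>\<^sup>+ s. emeasure (count_space E) (level_edges E g s (s + h)) \<partial>lborel)"
    by (intro nn_integral_cong nn_integral_indicator) (auto simp: level_edges_def)
  finally show ?thesis .
qed

text \<open>Taylor's formula with integral remainder at 0: the weight is the second derivative of
  the \<open>r\<close>-th power. It is nonnegative, and integrable near 0 because
  \<open>r - 2 > -1\<close>.\<close>

lemma powr_eq_nn_integral_excess:
  assumes "1 < r" "0 \<le> d"
  shows "ennreal (d powr r) =
    (\<integral>\<^sup>+ h. ennreal (indicator {0..} h * (r * (r - 1) * h powr (r - 2))) * ennreal (d - h) \<partial>lborel)"
proof -
  \<comment> \<open>The integrand multiplied out, so that each term is a power with a known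
    integral.\<close>
  let ?F = "\<lambda>h. r * (r - 1) * (d * h powr (r - 2) - h powr (r - 1))"
  have "(?F has_integral r * (r - 1) *
      (d * (d powr (r - 2 + 1) / (r - 2 + 1)) - d powr (r - 1 + 1) / (r - 1 + 1))) {0..d}"
    using assms by (intro has_integral_mult_right has_integral_diff has_integral_powr_from_0) auto
  moreover have "r * (r - 1) *
      (d * (d powr (r - 2 + 1) / (r - 2 + 1)) - d powr (r - 1 + 1) / (r - 1 + 1)) = d powr r"
  proof -
    have "d * d powr (r - 1) = d powr r"
      using assms by (cases "d = 0") (simp_all add: powr_diff)
    moreover have "r * (r - 1) * (X / (r - 1) - X / r) = X" for X
      using assms(1) by (simp add: divide_simps) (simp add: algebra_simps)
    ultimately show ?thesis by simp
  qed
  ultimately have int: "(?F has_integral d powr r) {0..d}" by simp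
  \<comment> \<open>The factored form shows that the integrand is nonnegative on
    \<open>{0..d}\<close>. At \<open>h = 0\<close> both sides vanish, as
    \<open>0 powr x = 0\<close>.\<close>
  have F: "?F h = r * (r - 1) * h powr (r - 2) * (d - h)" if "0 \<le> h" for h
  proof -
    have "h powr (r - 1) = h powr (r - 2) * h"
      using that by (cases "h = 0") (simp_all add: powr_diff power2_eq_square)
    then show ?thesis by (simp add: algebra_simps)
  qed
  have "ennreal (d powr r) = (\<integral>\<^sup>+ h. ennreal (indicator {0..d} h * ?F h) \<partial>lborel)"
    using int assms F by (subst nn_integral_has_integral_lebesgue[OF _ int]) auto
  \<comment> \<open>The truncation in \<open>ennreal (d - h)\<close> takes over the cutoff at
    \<open>d\<close>.\<close>
  also have "\<dots> = (\<integral>\<^sup>+ h. ennreal (indicator {0..} h * (r * (r - 1) * h powr (r - 2))) *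
      ennreal (d - h) \<partial>lborel)"
    using assms F
    by (intro nn_integral_cong) (auto simp: indicator_def ennreal_neg simp flip: ennreal_mult)
  finally show ?thesis .
qed

text \<open>Summed over the edges, the integral formula writes the sum of powers as an integral of
  \<open>excess\<close> against a nonnegative weight.\<close>

lemma nn_integral_edge_diff_powr_mono:
  assumes graph: "simple_graph V E" and count: "countable E"
    and excess: "\<And>h. 0 \<le> h \<Longrightarrow> excess E g h \<le> excess E f h"
    and "1 \<le> r"
  shows "(\<integral>\<^sup>+ e. ennreal (edge_diff g e powr r) \<partial>count_space E) \<le>
    (\<integral>\<^sup>+ e. ennreal (edge_diff f e powr r) \<partial>count_space E)"
proof (cases "r = 1")
  \<comment> \<open>For exponent 1 the weight degenerates to 0, but the sum is the excess at level
    0.\<close>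
  case True
  have "(\<integral>\<^sup>+ e. ennreal (edge_diff u e powr r) \<partial>count_space E) = excess E u 0" for u
    unfolding excess_def using True edge_diff_nonneg[OF graph, of _ u]
    by (intro nn_integral_cong) simp
  then show ?thesis using excess by simp
next
  case False
  then have "1 < r" using \<open>1 \<le> r\<close> by simp
  let ?w = "\<lambda>h. ennreal (indicator {0..} h * (r * (r - 1) * h powr (r - 2)))"
  have eq: "(\<integral>\<^sup>+ e. ennreal (edge_diff u e powr r) \<partial>count_space E) =
      (\<integral>\<^sup>+ h. ?w h * excess E u h \<partial>lborel)" for u
  proof -
    have "(\<integral>\<^sup>+ e. ennreal (edge_diff u e powr r) \<partial>count_space E) =
        (\<integral>\<^sup>+ e. (\<integral>\<^sup>+ h. ?w h * ennreal (edge_diff u e - h) \<partial>lborel) \<partial>count_space E)"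
      using \<open>1 < r\<close> edge_diff_nonneg[OF graph, of _ u]
      by (intro nn_integral_cong powr_eq_nn_integral_excess) auto
    also have "\<dots> = (\<integral>\<^sup>+ h. (\<integral>\<^sup>+ e. ?w h * ennreal (edge_diff u e - h) \<partial>count_space E) \<partial>lborel)"
      using count by (intro nn_integral_count_space_nn_integral[symmetric]) auto
    also have "\<dots> = (\<integral>\<^sup>+ h. ?w h * excess E u h \<partial>lborel)"
      unfolding excess_def by (intro nn_integral_cong nn_integral_cmult) simp
    finally show ?thesis .
  qed
  show ?thesis
    unfolding eq
  proof (rule nn_integral_mono)
    fix h :: real
    show "?w h * excess E g h \<le> ?w h * excess E f h"
      using excess[of h] by (cases "0 \<le> h") (auto intro: mult_left_mono)
  qed
qed

lemma ennreal_root_mono: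
  assumes "0 < r" "a \<le> b"
  shows "ennreal_root r a \<le> ennreal_root r b"
proof (cases "b = \<infinity>")
  case False
  then have "enn2real a \<le> enn2real b"
    using assms(2) by (intro enn2real_mono) (auto simp: top.not_eq_extremum)
  then show ?thesis
    using assms False by (auto simp: ennreal_root_def top_unique intro!: ennreal_leI powr_mono2)
qed (simp add: ennreal_root_def)

lemma grad_norm_mono:
  assumes graph: "simple_graph V E" and count: "countable E"
    and excess: "\<And>h. 0 \<le> h \<Longrightarrow> excess E g h \<le> excess E f h"
    and "1 \<le> p"
  shows "grad_norm E p g \<le> grad_norm E p f"
proof (cases "p = \<infinity>")
  case True
  show ?thesis
  proof (cases "grad_norm E p f")
    case (real h)
    have "ennreal (edge_diff f e) \<le> ennreal h" if "e \<in> E" for e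
      using that real True by (metis SUP_upper grad_norm_def)
    \<comment> \<open>All differences are at most \<open>h\<close> exactly when the excess at
      \<open>h\<close> vanishes; this carries the supremum bound from \<open>f\<close> to
      \<open>g\<close>.\<close>
    then have "excess E f h = 0"
      unfolding excess_def using real
      by (subst nn_integral_0_iff_AE) (auto simp: AE_count_space ennreal_eq_0_iff)
    then have "excess E g h = 0" using excess[OF real(1)] by simp
    then have "edge_diff g e \<le> h" if "e \<in> E" for e
      using that unfolding excess_def
      by (subst (asm) nn_integral_0_iff_AE) (auto simp: AE_count_space ennreal_eq_0_iff)
    then show ?thesis
      unfolding real(2) using True by (auto simp: grad_norm_def intro!: SUP_least ennreal_leI)
  qed simp
next
  case False
  then have "1 \<le> enn2real p"
    using \<open>1 \<le> p\<close> enn2real_mono[of 1 p] by (simp add: top.not_eq_extremum)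
  then show ?thesis
    using False nn_integral_edge_diff_powr_mono[OF graph count excess]
    by (auto simp: grad_norm_def intro!: ennreal_root_mono)
qed

theorem theorem4:
  fixes V :: "'a set" and E :: "'a set set" and v :: "nat \<Rightarrow> 'a"
    and f :: "'a \<Rightarrow> real" and p :: ennreal
  assumes "simple_graph V E"
    and "enumeration v V"
    and "\<And>N. N \<in> positions V \<Longrightarrow>
           finite (edge_boundary V E (v ` {1..N})) \<and>
           vertex_profile V E N = card (edge_boundary V E (v ` {1..N}))"
    and "\<And>N e x. N \<in> positions V \<Longrightarrow> e \<in> edge_boundary V E (v ` {1..N}) \<Longrightarrow> x \<in> e \<Longrightarrow>
           x \<in> v ` {1..N + vertex_profile V E N}"
    and "\<And>x. x \<in> V \<Longrightarrow> 0 \<le> f x"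
    and "1 \<le> p"
  shows "grad_norm E p (rearrangement V v f) \<le> grad_norm E p f"
proof -
  have "V = v ` positions V" using assms(2) by (auto simp: enumeration_def bij_betw_def)
  \<comment> \<open>Countably many edges are needed to exchange the sum over edges with integrals
    over levels.\<close>
  then have "countable V" by (metis countableI_type countable_image)
  with assms(1) have count: "countable E" by (rule simple_graph_countable)
  have "excess E (rearrangement V v f) h \<le> excess E f h" if "0 \<le> h" for h
    unfolding excess_eq_integral_level_edges[OF assms(1) count that]
    using that by (intro nn_integral_mono emeasure_level_edges_rearrangement[OF assms(1-5)]) auto
  with assms(1) count show ?thesis using assms(6) by (rule grad_norm_mono)
qed

end
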